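(* Let $A\in\mathbb{R}^{m\times n}$ and $b\in\mathbb{R}^m$. For $\lambda>0$, let $B_\lambda=A^TA+\lambda I\in\mathbb{R}^{n\times n}$ and let $B_\lambda=P_\lambda-R_\lambda+S_\lambda$ be a double weak splitting of type I (respectively, type II) with $\lim_{\lambda\to 0}B_\lambda^{-1}P_\lambda\ge 0$ (respectively, $\lim_{\lambda\to 0}P_\lambda B_\lambda^{-1}\ge 0$). Then the iterative scheme $$\begin{pmatrix}x^{k+1}\\ x^k\end{pmatrix}=\begin{pmatrix}P_\lambda^{-1}R_\lambda & -P_\lambda^{-1}S_\lambda\\ I & 0\end{pmatrix}\begin{pmatrix}x^k\\ x^{k-1}\end{pmatrix}+\begin{pmatrix}P_\lambda^{-1}A^Tb\\ 0\end{pmatrix}$$ converges to $B_\lambda^{-1}A^Tb$, which becomes $A^\dagger b$ as $\lambda\to 0$.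
   Context: Matrix inequalities are entrywise; $A^\dagger$ is the Moore-Penrose inverse; $I$ is the $n\times n$ identity. For a nonsingular $B\in\mathbb{R}^{n\times n}$, a decomposition $B=P-R+S$ with $P$ nonsingular is a double weak splitting of type I if $P^{-1}R\ge 0$ and $-P^{-1}S\ge 0$; for symmetric nonsingular $B$ it is a double weak splitting of type II if $RP^{-1}\ge 0$ and $-SP^{-1}\ge 0$. Convergence of the scheme means convergence of $x^k$ for arbitrary initial vectors $x^0,x^1$. $\lim_{\lambda\to0}$ denotes the limit as $\lambda\to 0$ through positive values (entrywise for matrices).
   Formalization: The limit of B_λ^{-1}P_λ (respectively P_λB_λ^{-1}) is additionally assumed nonsingular, and convergence of the scheme is asserted for all sufficiently small λ>0 rather than for every λ>0; without these changes the claim is false. *)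

theory Defs
  imports "HOL-Analysis.Analysis"
begin

text \<open>An \<open>m \<times> n\<close> real matrix is an element of \<open>real^'n^'m\<close>. The library order on nested
  vectors is the entrywise order, and its topology is that of entrywise convergence.\<close>

definition moore_penrose :: "real^'n^'m \<Rightarrow> real^'m^'n" where
  "moore_penrose A = (THE X. A ** X ** A = A \<and> X ** A ** X = X \<and>
     transpose (A ** X) = A ** X \<and> transpose (X ** A) = X ** A)"

definition double_weak_splitting_I ::
    "real^'n^'n \<Rightarrow> real^'n^'n \<Rightarrow> real^'n^'n \<Rightarrow> real^'n^'n \<Rightarrow> bool" where
  "double_weak_splitting_I B P R S \<longleftrightarrow>
     invertible B \<and> B = P - R + S \<and> invertible P \<and>
     matrix_inv P ** R \<ge> 0 \<and> - (matrix_inv P ** S) \<ge> 0"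

definition double_weak_splitting_II ::
    "real^'n^'n \<Rightarrow> real^'n^'n \<Rightarrow> real^'n^'n \<Rightarrow> real^'n^'n \<Rightarrow> bool" where
  "double_weak_splitting_II B P R S \<longleftrightarrow>
     invertible B \<and> transpose B = B \<and> B = P - R + S \<and> invertible P \<and>
     R ** matrix_inv P \<ge> 0 \<and> - (S ** matrix_inv P) \<ge> 0"

text \<open>Stacked vectors and \<open>2 \<times> 2\<close> block matrices, indexed by the sum type:
  \<open>Inl\<close> is the upper (left) block, \<open>Inr\<close> the lower (right) one.\<close>

definition stack_vec :: "real^'n \<Rightarrow> real^'n \<Rightarrow> real^('n + 'n)" where
  "stack_vec x y = (\<chi> i. case i of Inl a \<Rightarrow> x $ a | Inr a \<Rightarrow> y $ a)"

definition block_mat ::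
    "real^'n^'n \<Rightarrow> real^'n^'n \<Rightarrow> real^'n^'n \<Rightarrow> real^'n^'n \<Rightarrow> real^('n + 'n)^('n + 'n)" where
  "block_mat M11 M12 M21 M22 = (\<chi> i j.
     case i of
       Inl a \<Rightarrow> (case j of Inl c \<Rightarrow> M11 $ a $ c | Inr c \<Rightarrow> M12 $ a $ c)
     | Inr a \<Rightarrow> (case j of Inl c \<Rightarrow> M21 $ a $ c | Inr c \<Rightarrow> M22 $ a $ c))"

definition double_scheme ::
    "real^'n^'n \<Rightarrow> real^'n^'n \<Rightarrow> real^'n^'n \<Rightarrow> real^'n \<Rightarrow> (nat \<Rightarrow> real^'n) \<Rightarrow> bool" where
  "double_scheme P R S c x \<longleftrightarrow>
     (\<forall>k\<ge>1. stack_vec (x (k + 1)) (x k) =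
        block_mat (matrix_inv P ** R) (- (matrix_inv P ** S)) (mat 1) 0
          *v stack_vec (x k) (x (k - 1))
        + stack_vec (matrix_inv P *v c) 0)"

text \<open>The initial vectors \<open>x 0\<close> and \<open>x 1\<close> of a solution of the scheme are unconstrained, so
  quantifying over all solutions is quantifying over all pairs of initial vectors.\<close>

definition double_scheme_converges_to ::
    "real^'n^'n \<Rightarrow> real^'n^'n \<Rightarrow> real^'n^'n \<Rightarrow> real^'n \<Rightarrow> real^'n \<Rightarrow> bool" where
  "double_scheme_converges_to P R S c l \<longleftrightarrow>
     (\<forall>x. double_scheme P R S c x \<longrightarrow> x \<longlonglongrightarrow> l)"

definition regularized_gram :: "real^'n^'m \<Rightarrow> real \<Rightarrow> real^'n^'n" where
  "regularized_gram A t = transpose A ** A + t *\<^sub>R mat 1"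

end

theory Submission
  imports Defs
begin

text \<open>Put \<open>Q = B\<^sup>-\<^sup>1 P\<close> and \<open>T = P\<^sup>-\<^sup>1 R - P\<^sup>-\<^sup>1 S \<ge> 0\<close>, so that \<open>(I - T) Q = I\<close>, and let \<open>e\<close> be the
  all-ones vector. Since \<open>L \<ge> 0\<close> has no zero row, \<open>L e > 0\<close>; hence for small \<open>\<lambda>\<close> the vector
  \<open>w = Q e\<close> is positive, and \<open>T w = w - e < w\<close>. The weighted maximum norm defined by \<open>w\<close> then makes
  the error of the two-step scheme decay geometrically, without any spectral theory. Type II
  is the same argument for \<open>P x\<close> in place of \<open>x\<close>.

  For the limit, write \<open>y = A\<^sup>\<dagger> b\<close> and \<open>G = A\<^sup>T A\<close>. The Penrose equations give \<open>A\<^sup>T b = G y\<close> and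
  \<open>y = G u\<close> for some \<open>u\<close>, so \<open>z = B\<^sub>\<lambda>\<^sup>-\<^sup>1 A\<^sup>T b\<close> satisfies \<open>B\<^sub>\<lambda> (z - y + \<lambda> u) = \<lambda>\<^sup>2 u\<close>. As
  \<open>B\<^sub>\<lambda> \<ge> \<lambda> I\<close> in the semidefinite order, \<open>z - y = O(\<lambda>)\<close>.\<close>

section \<open>Matrix algebra\<close>

lemma
  fixes M :: "real^'n^'n"
  assumes "invertible M"
  shows matrix_inv_right: "M ** matrix_inv M = mat 1"
    and matrix_inv_left: "matrix_inv M ** M = mat 1"
proof -
  have "\<exists>M'. M ** M' = mat 1 \<and> M' ** M = mat 1"
    using assms by (simp add: invertible_def)
  then have "M ** matrix_inv M = mat 1 \<and> matrix_inv M ** M = mat 1"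
    unfolding matrix_inv_def by (rule someI_ex)
  then show "M ** matrix_inv M = mat 1" "matrix_inv M ** M = mat 1"
    by auto
qed

lemma matrix_vector_mult_minus_left: "(- M) *v v = - (M *v v)" for M :: "real^'n^'m"
  using matrix_vector_mult_diff_rdistrib[of 0 M v] by simp

lemma vec_less_of_eq_add_one: "w = v + 1 \<Longrightarrow> v $ i < w $ i" for v w :: "real^'n"
  by simp

section \<open>Nonnegative two-step recurrences\<close>

lemma abs_matrix_vector_mult_le:
  fixes M :: "real^'n^'m"
  assumes "0 \<le> M" and "\<And>j. \<bar>v $ j\<bar> \<le> w $ j"
  shows "\<bar>(M *v v) $ i\<bar> \<le> (M *v w) $ i"
proof -
  have M: "0 \<le> M $ i $ j" for j
    using assms(1) by (simp add: less_eq_vec_def)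
  have "\<bar>(M *v v) $ i\<bar> \<le> (\<Sum>j\<in>UNIV. \<bar>M $ i $ j * v $ j\<bar>)"
    by (simp add: matrix_vector_mult_def)
  also have "\<dots> \<le> (\<Sum>j\<in>UNIV. M $ i $ j * w $ j)"
    using M assms(2) by (intro sum_mono) (simp add: abs_mult mult_left_mono)
  finally show ?thesis
    by (simp add: matrix_vector_mult_def)
qed

text \<open>If two consecutive terms are at most \<open>s\<close> times \<open>w\<close> in absolute
  value, the next is at most \<open>s\<close> times \<open>(U + V) *v w\<close>, a fixed fraction of
  \<open>s\<close> times \<open>w\<close>. A decay rate \<rho> per index therefore suffices as soon
  as \<theta> \<le> \<rho> * \<rho>.\<close>

lemma two_step_recurrence_tendsto_zero:
  fixes U V :: "real^'n^'n"
  assumes U: "0 \<le> U" and V: "0 \<le> V"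
    and w: "\<And>i. 0 < w $ i" and contr: "\<And>i. ((U + V) *v w) $ i < w $ i"
    and d: "\<And>k. d (Suc (Suc k)) = U *v d (Suc k) + V *v d k"
  shows "d \<longlonglongrightarrow> 0"
proof -
  define \<theta> where "\<theta> = Max (range (\<lambda>i. ((U + V) *v w) $ i / w $ i))"
  have UVw: "0 \<le> ((U + V) *v w) $ i" for i
    using abs_matrix_vector_mult_le[of "U + V" 0 w i] U V w
    by (simp add: less_imp_le less_eq_vec_def)
  have \<theta>_ge: "((U + V) *v w) $ i / w $ i \<le> \<theta>" for i
    unfolding \<theta>_def by (rule Max_ge) auto
  \<comment> \<open>The maximum over the finitely many indices is attained, so the strict
    inequalities of \<open>contr\<close> give \<theta> < 1.\<close>
  have \<theta>_in: "\<theta> \<in> range (\<lambda>i. ((U + V) *v w) $ i / w $ i)"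
    unfolding \<theta>_def by (rule Max_in) auto
  then have \<theta>: "0 \<le> \<theta>" "\<theta> < 1"
    using UVw w contr by (auto simp: less_imp_le)
  have \<theta>w: "((U + V) *v w) $ i \<le> \<theta> * w $ i" for i
    using \<theta>_ge[of i] w[of i] by (simp add: divide_le_eq)
  \<comment> \<open>Taking the midpoint of \<theta> and 1 keeps \<rho> positive even when \<theta> =
    0; \<rho> is a divisor below.\<close>
  define \<rho> where "\<rho> = sqrt ((1 + \<theta>) / 2)"
  have \<rho>: "0 < \<rho>" "\<rho> < 1" and \<rho>2: "\<rho> * \<rho> = (1 + \<theta>) / 2"
    using \<theta> by (auto simp: \<rho>_def)
  have \<rho>w: "((U + V) *v w) $ i \<le> \<rho> * \<rho> * w $ i" for i
  proof -
    have "\<theta> * w $ i \<le> \<rho> * \<rho> * w $ i"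
      using w[of i] \<theta> by (intro mult_right_mono) (auto simp: \<rho>2)
    with \<theta>w[of i] show ?thesis by linarith
  qed
  have quotient_nonneg: "0 \<le> (\<bar>d 0 $ i\<bar> + \<bar>d 1 $ i\<bar> / \<rho>) / w $ i" for i
    using w[of i] \<rho>(1) by simp
  \<comment> \<open>Each summand encodes both initial bounds, \<open>C * w\<close> for
    \<open>d 0\<close> and \<open>C * \<rho> * w\<close> for \<open>d 1\<close>; a sum of
    nonnegative terms dominates each of them.\<close>
  define C where "C = (\<Sum>i\<in>UNIV. (\<bar>d 0 $ i\<bar> + \<bar>d 1 $ i\<bar> / \<rho>) / w $ i)"
  have C: "(\<bar>d 0 $ i\<bar> + \<bar>d 1 $ i\<bar> / \<rho>) / w $ i \<le> C" for i
    unfolding C_def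
    by (rule member_le_sum[OF _ quotient_nonneg]) simp_all
  have C': "\<bar>d 0 $ i\<bar> + \<bar>d 1 $ i\<bar> / \<rho> \<le> C * w $ i" for i
    using C[of i] by (simp only: pos_divide_le_eq[OF w])
  have C0: "0 \<le> C"
    unfolding C_def by (rule sum_nonneg[OF quotient_nonneg])
  have bound: "(\<forall>i. \<bar>d k $ i\<bar> \<le> C * \<rho> ^ k * w $ i) \<and>
      (\<forall>i. \<bar>d (Suc k) $ i\<bar> \<le> C * \<rho> ^ Suc k * w $ i)" for k
  proof (induction k)
    case 0
    have "\<bar>d 0 $ i\<bar> \<le> C * w $ i" "\<bar>d 1 $ i\<bar> \<le> C * \<rho> * w $ i" for i
    proof -
      have "0 \<le> \<bar>d 1 $ i\<bar> / \<rho>" using \<rho> by simp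
      then show "\<bar>d 0 $ i\<bar> \<le> C * w $ i" using C'[of i] by linarith
      have "\<bar>d 1 $ i\<bar> / \<rho> \<le> C * w $ i" using C'[of i] by linarith
      then show "\<bar>d 1 $ i\<bar> \<le> C * \<rho> * w $ i" using \<rho> by (simp add: pos_divide_le_eq mult_ac)
    qed
    then show ?case by simp
  next
    case (Suc k)
    have "\<bar>d (Suc (Suc k)) $ i\<bar> \<le> C * \<rho> ^ Suc (Suc k) * w $ i" for i
    proof -
      define s where "s = C * \<rho> ^ k"
      have s: "0 \<le> s" using C0 \<rho> by (simp add: s_def)
      have dk: "\<bar>d k $ j\<bar> \<le> (s *\<^sub>R w) $ j" for j
        using Suc by (simp add: s_def)
      \<comment> \<open>Giving up the factor \<rho> bounds both preceding terms by the same vector,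
        so that \<open>U\<close> and \<open>V\<close> recombine into \<open>U + V\<close>.\<close>
      have dSk: "\<bar>d (Suc k) $ j\<bar> \<le> (s *\<^sub>R w) $ j" for j
      proof -
        have "\<bar>d (Suc k) $ j\<bar> \<le> \<rho> * (s * w $ j)"
          using Suc by (simp add: s_def mult_ac)
        also have "\<dots> \<le> s * w $ j"
          using s \<rho> w[of j] by (intro mult_left_le_one_le) auto
        finally show ?thesis by simp
      qed
      have "\<bar>d (Suc (Suc k)) $ i\<bar> \<le> \<bar>(U *v d (Suc k)) $ i\<bar> + \<bar>(V *v d k) $ i\<bar>"
        by (simp add: d)
      also have "\<dots> \<le> (U *v (s *\<^sub>R w)) $ i + (V *v (s *\<^sub>R w)) $ i"
        by (intro add_mono abs_matrix_vector_mult_le U V dk dSk)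
      also have "\<dots> = s * ((U + V) *v w) $ i"
        by (simp add: matrix_vector_mult_scaleR matrix_vector_mult_add_rdistrib algebra_simps)
      also have "\<dots> \<le> s * (\<rho> * \<rho> * w $ i)"
        by (intro mult_left_mono \<rho>w s)
      finally show ?thesis by (simp add: s_def mult_ac)
    qed
    with Suc show ?case by blast
  qed
  have "(\<lambda>k. d k $ i) \<longlonglongrightarrow> 0" for i
  proof (rule Lim_null_comparison)
    show "\<forall>\<^sub>F k in sequentially. norm (d k $ i) \<le> C * w $ i * \<rho> ^ k"
      using bound by (simp add: mult_ac)
    show "(\<lambda>k. C * w $ i * \<rho> ^ k) \<longlonglongrightarrow> 0"
      using \<rho> by (intro tendsto_mult_right_zero LIMSEQ_power_zero) auto
  qed
  then show ?thesis
    by (intro vec_tendstoI) simp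
qed

text \<open>A nonnegative row with sum 0 vanishes, and then so does that row of
  \<open>L ** matrix_inv L\<close>, whose diagonal entry is 1.\<close>

lemma nonneg_invertible_row_sum_pos:
  fixes L :: "real^'n^'n"
  assumes "0 \<le> L" and "invertible L"
  shows "0 < (L *v 1) $ i"
proof (rule ccontr)
  assume neg: "\<not> 0 < (L *v 1) $ i"
  have L: "0 \<le> L $ i $ j" for j
    using assms(1) by (simp add: less_eq_vec_def)
  have "(\<Sum>j\<in>UNIV. L $ i $ j) = 0"
    using neg L sum_nonneg[of UNIV "\<lambda>j. L $ i $ j"]
    by (simp add: matrix_vector_mult_def)
  then have "L $ i $ j = 0" for j
    using L by (simp add: sum_nonneg_eq_0_iff)
  then have "(L ** matrix_inv L) $ i $ i = 0"
    by (simp add: matrix_matrix_mult_def)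
  then show False
    using matrix_inv_right[OF assms(2)] by (simp add: mat_def)
qed

lemma eventually_row_sum_pos:
  fixes L :: "real^'n^'n"
  assumes "(Q \<longlongrightarrow> L) F" and "0 \<le> L" and "invertible L"
  shows "\<forall>\<^sub>F t in F. \<forall>i. 0 < (Q t *v 1) $ i"
proof -
  have "\<forall>\<^sub>F t in F. 0 < (Q t *v 1) $ i" for i
  proof -
    have "((\<lambda>t. \<Sum>j\<in>UNIV. Q t $ i $ j) \<longlongrightarrow> (\<Sum>j\<in>UNIV. L $ i $ j)) F"
      by (intro tendsto_sum tendsto_vec_nth assms(1))
    then have "((\<lambda>t. (Q t *v 1) $ i) \<longlongrightarrow> (L *v 1) $ i) F"
      by (simp add: matrix_vector_mult_def)
    then show ?thesis
      by (rule order_tendstoD) (rule nonneg_invertible_row_sum_pos[OF assms(2,3)])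
  qed
  then show ?thesis
    by (simp add: eventually_all_finite)
qed

section \<open>Convergence of the double scheme\<close>

lemma block_mat_mult_stack_vec:
  "block_mat M11 M12 M21 M22 *v stack_vec x y =
     stack_vec (M11 *v x + M12 *v y) (M21 *v x + M22 *v y)"
proof -
  have "(\<Sum>i\<in>UNIV. f i) = (\<Sum>a\<in>UNIV. f (Inl a)) + (\<Sum>a\<in>UNIV. f (Inr a))"
    for f :: "'a + 'a \<Rightarrow> real"
    by (simp add: UNIV_Plus_UNIV[symmetric] sum.Plus del: UNIV_Plus_UNIV)
  then show ?thesis
    by (auto simp: vec_eq_iff block_mat_def stack_vec_def matrix_vector_mult_def split: sum.split)
qed

lemma double_schemeD:
  assumes "double_scheme P R S c x"
  shows "x (Suc (Suc k)) =
    (matrix_inv P ** R) *v x (Suc k) + (- (matrix_inv P ** S)) *v x k + matrix_inv P *v c"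
proof -
  have "stack_vec (x (Suc k + 1)) (x (Suc k)) =
        block_mat (matrix_inv P ** R) (- (matrix_inv P ** S)) (mat 1) 0
          *v stack_vec (x (Suc k)) (x (Suc k - 1))
        + stack_vec (matrix_inv P *v c) 0"
    using assms unfolding double_scheme_def by simp
  \<comment> \<open>Only the upper block carries the recurrence; the lower one repeats
    \<open>x (Suc k)\<close>.\<close>
  then have "stack_vec (x (Suc k + 1)) (x (Suc k)) $ Inl i =
        (stack_vec ((matrix_inv P ** R) *v x (Suc k) + (- (matrix_inv P ** S)) *v x k)
          (mat 1 *v x (Suc k) + 0 *v x k)
        + stack_vec (matrix_inv P *v c) 0) $ Inl i" for i
    by (simp add: block_mat_mult_stack_vec)
  then show ?thesis
    by (simp add: vec_eq_iff stack_vec_def)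
qed

text \<open>Used twice: with the vector \<open>c\<close> of the scheme it makes the error recurrence
  homogeneous, and with a special \<open>c\<close> it produces the weight \<open>w\<close>.\<close>

lemma splitting_fixed_point:
  fixes P :: "real^'n^'n" and c :: "real^'n"
  assumes "invertible B" and "invertible P" and "B = P - R + S"
  defines "l \<equiv> matrix_inv B *v c"
  shows "l = (matrix_inv P ** R) *v l + (- (matrix_inv P ** S)) *v l + matrix_inv P *v c"
proof -
  have "B *v l = c"
    by (simp add: l_def matrix_vector_mul_assoc matrix_inv_right[OF assms(1)])
  then have "P *v l = R *v l - S *v l + c"
    by (simp add: assms(3) matrix_vector_mult_add_rdistrib matrix_vector_mult_diff_rdistrib
        algebra_simps)
  then have "matrix_inv P *v (P *v l) = matrix_inv P *v (R *v l - S *v l + c)"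
    by simp
  then show ?thesis
    by (simp add: matrix_vector_mult_minus_left matrix_vector_mul_assoc matrix_inv_left[OF assms(2)]
        matrix_vector_mult_diff_distrib matrix_vector_right_distrib)
qed

lemma double_scheme_error:
  fixes P :: "real^'n^'n" and c :: "real^'n" and x :: "nat \<Rightarrow> real^'n"
  assumes "invertible B" and "invertible P" and "B = P - R + S" and "double_scheme P R S c x"
  defines "d \<equiv> \<lambda>k. x k - matrix_inv B *v c"
  shows "d (Suc (Suc k)) = (matrix_inv P ** R) *v d (Suc k) + (- (matrix_inv P ** S)) *v d k"
proof -
  note * = double_schemeD[OF assms(4), of k] splitting_fixed_point[OF assms(1-3), of c]
  show ?thesis
    unfolding d_def matrix_vector_mult_diff_distrib
    by (subst (1) *(1), subst (1) *(2)) simp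
qed

lemma double_weak_splitting_I_converges:
  assumes spl: "double_weak_splitting_I B P R S"
    and w: "\<And>i. 0 < ((matrix_inv B ** P) *v 1) $ i"
  shows "double_scheme_converges_to P R S c (matrix_inv B *v c)"
  unfolding double_scheme_converges_to_def
proof (intro allI impI)
  fix x assume x: "double_scheme P R S c x"
  have inv: "invertible B" "invertible P" and B: "B = P - R + S"
    and nn: "0 \<le> matrix_inv P ** R" "0 \<le> - (matrix_inv P ** S)"
    using spl by (auto simp: double_weak_splitting_I_def)
  let ?w = "(matrix_inv B ** P) *v 1"
  have l: "matrix_inv B *v (P *v 1) = ?w" "matrix_inv P *v (P *v 1) = 1"
    by (simp_all add: matrix_vector_mul_assoc matrix_inv_left[OF inv(2)])
  \<comment> \<open>The choice \<open>c = P *v 1\<close> makes the inhomogeneous term 1 and the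
    fixed point \<open>?w\<close>.\<close>
  have "?w = (matrix_inv P ** R + - (matrix_inv P ** S)) *v ?w + 1"
    unfolding matrix_vector_mult_add_rdistrib
    by (rule splitting_fixed_point[OF inv B, of "P *v 1", unfolded l])
  then have "((matrix_inv P ** R + - (matrix_inv P ** S)) *v ?w) $ i < ?w $ i" for i
    by (rule vec_less_of_eq_add_one)
  then have "(\<lambda>k. x k - matrix_inv B *v c) \<longlonglongrightarrow> 0"
    by (intro two_step_recurrence_tendsto_zero[OF nn w] double_scheme_error inv B x)
  then show "x \<longlonglongrightarrow> matrix_inv B *v c"
    by (rule LIM_zero_cancel)
qed

lemma double_weak_splitting_II_converges:
  assumes spl: "double_weak_splitting_II B P R S"
    and w: "\<And>i. 0 < ((P ** matrix_inv B) *v 1) $ i"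
  shows "double_scheme_converges_to P R S c (matrix_inv B *v c)"
  unfolding double_scheme_converges_to_def
proof (intro allI impI)
  fix x assume x: "double_scheme P R S c x"
  have inv: "invertible B" "invertible P" and B: "B = P - R + S"
    and nn: "0 \<le> R ** matrix_inv P" "0 \<le> - (S ** matrix_inv P)"
    using spl by (auto simp: double_weak_splitting_II_def)
  let ?w = "(P ** matrix_inv B) *v 1"
  define d where "d k = x k - matrix_inv B *v c" for k
  have cancel: "matrix_inv P *v (P *v v) = v" "P *v (matrix_inv P *v v) = v" for v
    by (simp_all add: matrix_vector_mul_assoc matrix_inv_left[OF inv(2)]
        matrix_inv_right[OF inv(2)])
  \<comment> \<open>Conjugation by \<open>P\<close> replaces the iteration matrices by those that
    type II makes nonnegative.\<close>
  have conj: "P *v ((matrix_inv P ** R) *v u + (- (matrix_inv P ** S)) *v v) =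
      (R ** matrix_inv P) *v (P *v u) + (- (S ** matrix_inv P)) *v (P *v v)" for u v
    by (simp add: matrix_vector_mult_minus_left matrix_vector_right_distrib
        matrix_vector_mult_diff_distrib matrix_vector_mul_assoc[symmetric] cancel)
  let ?l = "matrix_inv B *v 1"
  have l: "P *v ?l = ?w"
    by (rule matrix_vector_mul_assoc)
  have "P *v ?l = P *v ((matrix_inv P ** R) *v ?l + (- (matrix_inv P ** S)) *v ?l
      + matrix_inv P *v 1)"
    by (rule arg_cong[OF splitting_fixed_point[OF inv B]])
  also have "\<dots> = P *v ((matrix_inv P ** R) *v ?l + (- (matrix_inv P ** S)) *v ?l) + 1"
    by (simp only: matrix_vector_right_distrib[of P _ "matrix_inv P *v 1"] cancel)
  finally have fp: "P *v ?l =
      P *v ((matrix_inv P ** R) *v ?l + (- (matrix_inv P ** S)) *v ?l) + 1" .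
  have "?w = (R ** matrix_inv P + - (S ** matrix_inv P)) *v ?w + 1"
    unfolding matrix_vector_mult_add_rdistrib by (rule fp[unfolded conj l])
  then have contr: "((R ** matrix_inv P + - (S ** matrix_inv P)) *v ?w) $ i < ?w $ i" for i
    by (rule vec_less_of_eq_add_one)
  have "P *v d (Suc (Suc k)) =
      (R ** matrix_inv P) *v (P *v d (Suc k)) + (- (S ** matrix_inv P)) *v (P *v d k)" for k
    unfolding d_def double_scheme_error[OF inv B x] by (rule conj)
  then have "(\<lambda>k. P *v d k) \<longlonglongrightarrow> 0"
    by (intro two_step_recurrence_tendsto_zero[OF nn w contr])
  then have "(\<lambda>k. matrix_inv P *v (P *v d k)) \<longlonglongrightarrow> matrix_inv P *v 0"
    by (rule bounded_linear.tendsto[OF matrix_vector_mul_bounded_linear])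
  then have "d \<longlonglongrightarrow> 0"
    by (simp add: cancel)
  then show "x \<longlonglongrightarrow> matrix_inv B *v c"
    unfolding d_def by (rule LIM_zero_cancel)
qed

section \<open>The Moore-Penrose inverse\<close>

text \<open>Project \<open>b\<close> orthogonally onto the range of \<open>A\<close>; the remainder
  is annihilated by \<open>transpose A\<close>.\<close>

lemma normal_equation_solvable:
  fixes A :: "real^'n^'m"
  shows "\<exists>y. transpose A *v (A *v y) = transpose A *v b"
proof -
  obtain p r where p: "p \<in> span (range ((*v) A))"
    and r: "\<And>u. u \<in> span (range ((*v) A)) \<Longrightarrow> orthogonal r u" and b: "b = p + r"
    using orthogonal_subspace_decomp_exists[of "range ((*v) A)" b] by blast
  have "subspace (range ((*v) A))"
    by (intro linear_subspace_image subspace_UNIV) simp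
  then obtain y where y: "p = A *v y"
    using p by (metis imageE span_eq_iff)
  have "(transpose A *v r) \<bullet> v = 0" for v
    using r[of "A *v v"] by (simp add: dot_lmul_matrix[symmetric] orthogonal_def span_base)
  then have "transpose A *v r = 0"
    using inner_eq_zero_iff by blast
  then have "transpose A *v (A *v y) = transpose A *v b"
    by (simp add: b y matrix_vector_right_distrib)
  then show ?thesis ..
qed

text \<open>Least-squares solutions for the unit vectors, taken as columns of \<open>K\<close>, give
  \<open>transpose A ** (A ** K) = transpose A\<close>; both equations follow by
  transposing.\<close>

lemma exists_penrose_13_inverse:
  fixes A :: "real^'n^'m"
  shows "\<exists>K. A ** K ** A = A \<and> transpose (A ** K) = A ** K"
proof -
  have "\<exists>y. transpose A *v (A *v y) = transpose A *v axis j 1" for j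
    by (rule normal_equation_solvable)
  then obtain f where f: "\<And>j. transpose A *v (A *v f j) = transpose A *v axis j 1"
    by metis
  define K where "K = transpose (\<chi> j. f j)"
  have col: "K *v axis j 1 = f j" for j
    by (simp add: K_def matrix_vector_mult_basis column_transpose row_def)
  have "(transpose A ** (A ** K)) *v axis j 1 = transpose A *v axis j 1" for j
    using f[of j] by (simp add: matrix_vector_mul_assoc[symmetric] col)
  then have "column j (transpose A ** (A ** K)) = column j (transpose A)" for j
    by (simp only: matrix_vector_mult_basis)
  then have K: "transpose A ** (A ** K) = transpose A"
    by (simp add: column_def vec_eq_iff)
  have KA: "transpose K ** transpose A ** A = A"
    using arg_cong[OF K, of transpose] by (simp add: matrix_transpose_mul)
  have "transpose K ** transpose A ** (A ** K) = transpose K ** transpose A"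
    using K by (simp add: matrix_mul_assoc[symmetric])
  then have AK: "A ** K = transpose K ** transpose A"
    using KA by (simp add: matrix_mul_assoc)
  show ?thesis
    using AK KA by (intro exI[of _ K]) (simp add: matrix_transpose_mul)
qed

text \<open>Urquhart's formula \<open>N ** A ** K\<close>: \<open>K\<close> supplies the symmetry of
  the product with \<open>A\<close> on the left, and \<open>N\<close>, the transpose of such an
  inverse of \<open>transpose A\<close>, that of the product with \<open>A\<close> on the
  right.\<close>

lemma exists_penrose_inverse:
  fixes A :: "real^'n^'m"
  shows "\<exists>X. A ** X ** A = A \<and> X ** A ** X = X \<and>
     transpose (A ** X) = A ** X \<and> transpose (X ** A) = X ** A"
proof -
  obtain K where K: "A ** K ** A = A" "transpose (A ** K) = A ** K"
    using exists_penrose_13_inverse by blast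
  obtain M where M: "transpose A ** M ** transpose A = transpose A"
      "transpose (transpose A ** M) = transpose A ** M"
    using exists_penrose_13_inverse by blast
  define N where "N = transpose M"
  have N: "A ** N ** A = A" "transpose (N ** A) = N ** A"
    using arg_cong[OF M(1), of transpose] M(2)
    by (simp_all add: N_def matrix_transpose_mul matrix_mul_assoc)
  have AX: "A ** (N ** A ** K) = A ** K" and XA: "N ** A ** K ** A = N ** A"
    using K(1) N(1) by (simp_all add: matrix_mul_assoc) (simp add: matrix_mul_assoc[symmetric])
  have "N ** A ** K ** A ** (N ** A ** K) = N ** (A ** (N ** A ** K))"
    unfolding XA by (rule matrix_mul_assoc[symmetric])
  also have "\<dots> = N ** A ** K"
    unfolding AX by (rule matrix_mul_assoc)
  finally have "N ** A ** K ** A ** (N ** A ** K) = N ** A ** K" .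
  with AX XA K N show ?thesis
    by (intro exI[of _ "N ** A ** K"]) simp
qed

text \<open>Transposing a product of two symmetric projections swaps its factors, which forces
  \<open>A ** X = A ** Y\<close> and \<open>X ** A = Y ** A\<close>. Then X = XAX = YAX = YAY =
  Y.\<close>

lemma penrose_inverse_unique:
  fixes A :: "real^'n^'m"
  assumes X: "A ** X ** A = A" "X ** A ** X = X"
      "transpose (A ** X) = A ** X" "transpose (X ** A) = X ** A"
    and Y: "A ** Y ** A = A" "Y ** A ** Y = Y"
      "transpose (A ** Y) = A ** Y" "transpose (Y ** A) = Y ** A"
  shows "X = Y"
proof -
  have "A ** X = (A ** Y) ** (A ** X)"
    using Y(1) by (simp add: matrix_mul_assoc)
  then have "A ** X = transpose ((A ** Y) ** (A ** X))"
    using X(3) by simp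
  also have "\<dots> = (A ** X) ** (A ** Y)"
    by (subst matrix_transpose_mul) (simp add: X(3) Y(3))
  finally have AX: "A ** X = A ** Y"
    using X(1) by (simp add: matrix_mul_assoc)
  have "X ** A = (X ** A) ** (Y ** A)"
    using Y(1) by (simp add: matrix_mul_assoc[symmetric])
  then have "X ** A = transpose ((X ** A) ** (Y ** A))"
    using X(4) by simp
  also have "\<dots> = (Y ** A) ** (X ** A)"
    by (subst matrix_transpose_mul) (simp add: X(4) Y(4))
  finally have XA: "X ** A = Y ** A"
    using X(1) by (simp add: matrix_mul_assoc[symmetric])
  have "X = Y ** (A ** X)"
    using X(2) by (simp add: XA matrix_mul_assoc)
  also have "\<dots> = Y"
    using Y(2) by (simp add: AX matrix_mul_assoc)
  finally show ?thesis .
qed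

lemma moore_penrose:
  fixes A :: "real^'n^'m"
  shows "A ** moore_penrose A ** A = A"
    and "moore_penrose A ** A ** moore_penrose A = moore_penrose A"
    and "transpose (A ** moore_penrose A) = A ** moore_penrose A"
    and "transpose (moore_penrose A ** A) = moore_penrose A ** A"
proof -
  let ?P = "\<lambda>X. A ** X ** A = A \<and> X ** A ** X = X \<and>
     transpose (A ** X) = A ** X \<and> transpose (X ** A) = X ** A"
  have "\<exists>!X. ?P X"
    using exists_penrose_inverse[of A] penrose_inverse_unique[of A] by blast
  then have "?P (moore_penrose A)"
    unfolding moore_penrose_def by (rule theI')
  then show "A ** moore_penrose A ** A = A"
    and "moore_penrose A ** A ** moore_penrose A = moore_penrose A"
    and "transpose (A ** moore_penrose A) = A ** moore_penrose A"
    and "transpose (moore_penrose A ** A) = moore_penrose A ** A"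
    by auto
qed

section \<open>Limit of the regularized solutions\<close>

lemma gram_mult_moore_penrose:
  "transpose A ** A ** moore_penrose A = transpose A"
  using arg_cong[OF moore_penrose(1)[of A], of transpose]
  by (simp add: matrix_transpose_mul[of "A ** moore_penrose A"] moore_penrose(3) matrix_mul_assoc)

lemma moore_penrose_in_range_gram:
  fixes A :: "real^'n^'m"
  shows "\<exists>u. moore_penrose A *v b = (transpose A ** A) *v u"
proof -
  let ?X = "moore_penrose A"
  have "?X = transpose A ** transpose ?X ** ?X"
    using moore_penrose(2,4)[of A] by (simp add: matrix_transpose_mul)
  also have "\<dots> = (transpose A ** A) ** (?X ** transpose ?X ** ?X)"
    using gram_mult_moore_penrose[of A] by (simp add: matrix_mul_assoc)
  finally have "?X *v b = (transpose A ** A) *v ((?X ** transpose ?X ** ?X) *v b)"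
    by (simp only: matrix_vector_mul_assoc)
  then show ?thesis ..
qed

text \<open>In the inner product with \<open>v\<close> the Gram part contributes the square of the
  norm of \<open>A *v v\<close>, which is nonnegative; Cauchy-Schwarz then allows cancelling
  \<open>norm v\<close>.\<close>

lemma norm_le_norm_regularized_gram_mult:
  fixes A :: "real^'n^'m"
  shows "t * norm v \<le> norm (regularized_gram A t *v v)"
proof (cases "v = 0")
  case False
  have "v \<bullet> ((transpose A ** A) *v v) = (A *v v) \<bullet> (A *v v)"
    by (simp add: matrix_vector_mul_assoc[symmetric] inner_commute[of v] dot_lmul_matrix)
  then have "v \<bullet> (regularized_gram A t *v v) = (A *v v) \<bullet> (A *v v) + t * (v \<bullet> v)"
    by (simp add: regularized_gram_def matrix_vector_mult_add_rdistrib inner_right_distrib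
        scaleR_matrix_vector_assoc[symmetric])
  then have "t * (v \<bullet> v) \<le> v \<bullet> (regularized_gram A t *v v)"
    by simp
  also have "\<dots> \<le> norm v * norm (regularized_gram A t *v v)"
    by (rule norm_cauchy_schwarz)
  finally have "norm v * (t * norm v) \<le> norm v * norm (regularized_gram A t *v v)"
    by (simp add: dot_square_norm power2_eq_square mult_ac)
  with False show ?thesis
    by simp
qed simp

lemma regularized_gram_tendsto_moore_penrose:
  fixes A :: "real^'n^'m"
  assumes inv: "\<And>t. 0 < t \<Longrightarrow> invertible (regularized_gram A t)"
  shows "((\<lambda>t. matrix_inv (regularized_gram A t) *v (transpose A *v b))
    \<longlongrightarrow> moore_penrose A *v b) (at_right 0)"
proof -
  define y where "y = moore_penrose A *v b"
  obtain u where u: "y = (transpose A ** A) *v u"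
    using moore_penrose_in_range_gram unfolding y_def by blast
  have reg: "regularized_gram A t *v v = (transpose A ** A) *v v + t *\<^sub>R v" for t v
    by (simp add: regularized_gram_def matrix_vector_mult_add_rdistrib
        scaleR_matrix_vector_assoc[symmetric])
  have bound: "norm (matrix_inv (regularized_gram A t) *v (transpose A *v b) - y) \<le> 2 * (t * norm u)"
    if t: "0 < t" for t
  proof -
    define z where "z = matrix_inv (regularized_gram A t) *v (transpose A *v b)"
    have "regularized_gram A t *v z = (transpose A ** A) *v y"
      by (simp add: z_def matrix_vector_mul_assoc matrix_inv_right[OF inv[OF t]]
          gram_mult_moore_penrose y_def)
    moreover have "regularized_gram A t *v y = (transpose A ** A) *v y + t *\<^sub>R y"
      by (rule reg)
    \<comment> \<open>The residual of \<open>z - y\<close> is \<open>- t *\<^sub>R y\<close>; the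
      correction \<open>t *\<^sub>R u\<close> cancels it up to second order.\<close>
    moreover have "regularized_gram A t *v (t *\<^sub>R u) = t *\<^sub>R y + (t * t) *\<^sub>R u"
      by (simp add: reg matrix_vector_mult_scaleR u scaleR_add_right)
    ultimately have "regularized_gram A t *v (z - y + t *\<^sub>R u) = (t * t) *\<^sub>R u"
      by (simp add: matrix_vector_mult_diff_distrib matrix_vector_right_distrib)
    then have "t * norm (z - y + t *\<^sub>R u) \<le> t * (t * norm u)"
      using norm_le_norm_regularized_gram_mult[of t "z - y + t *\<^sub>R u" A] t by simp
    then have "norm (z - y + t *\<^sub>R u) \<le> t * norm u"
      using t by simp
    moreover have "norm (z - y) \<le> norm (z - y + t *\<^sub>R u) + norm (t *\<^sub>R u)"
      using norm_triangle_ineq4[of "z - y + t *\<^sub>R u" "t *\<^sub>R u"] by simp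
    ultimately show ?thesis
      using t unfolding z_def by simp
  qed
  have "((\<lambda>t. matrix_inv (regularized_gram A t) *v (transpose A *v b) - y) \<longlongrightarrow> 0) (at_right 0)"
  proof (rule Lim_null_comparison)
    show "\<forall>\<^sub>F t in at_right 0.
        norm (matrix_inv (regularized_gram A t) *v (transpose A *v b) - y) \<le> 2 * (t * norm u)"
      using eventually_at_right_less by (rule eventually_mono) (rule bound)
    show "((\<lambda>t. 2 * (t * norm u)) \<longlongrightarrow> 0) (at_right 0)"
      by (rule tendsto_mult_right_zero, rule tendsto_mult_left_zero, rule tendsto_ident_at)
  qed
  then show ?thesis
    unfolding y_def by (rule LIM_zero_cancel)
qed

text \<open>Invertibility of \<open>L\<close> excludes zero rows, so that row sums are positive for
  all small \<open>t\<close>. With \<open>L = 0\<close> convergence can fail: for 1 by 1 matrices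
  take A = 0, P = -t^2, R = -t - t^2, S = 0, where the iteration factor is (1 + t) / t.\<close>

theorem theorem3p19:
  fixes A :: "real^'n^'m" and b :: "real^'m"
    and B P R S :: "real \<Rightarrow> real^'n^'n" and L :: "real^'n^'n"
  defines "B \<equiv> regularized_gram A"
  assumes splitting:
    "((\<forall>t>0. double_weak_splitting_I (B t) (P t) (R t) (S t)) \<and>
        ((\<lambda>t. matrix_inv (B t) ** P t) \<longlongrightarrow> L) (at_right 0)) \<or>
     ((\<forall>t>0. double_weak_splitting_II (B t) (P t) (R t) (S t)) \<and>
        ((\<lambda>t. P t ** matrix_inv (B t)) \<longlongrightarrow> L) (at_right 0))"
    and limit_nonneg: "L \<ge> 0"
    and limit_nonsingular: "invertible L"
  shows "(\<forall>\<^sub>F t in at_right 0.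
            double_scheme_converges_to (P t) (R t) (S t) (transpose A *v b)
              (matrix_inv (B t) *v (transpose A *v b))) \<and>
         ((\<lambda>t. matrix_inv (B t) *v (transpose A *v b)) \<longlongrightarrow> moore_penrose A *v b) (at_right 0)"
proof
  have pos: "\<forall>\<^sub>F t in at_right (0::real). 0 < t"
    by (rule eventually_at_right_less)
  show "\<forall>\<^sub>F t in at_right 0.
            double_scheme_converges_to (P t) (R t) (S t) (transpose A *v b)
              (matrix_inv (B t) *v (transpose A *v b))"
    using splitting
  proof (elim disjE conjE)
    assume spl: "\<forall>t>0. double_weak_splitting_I (B t) (P t) (R t) (S t)"
      and lim: "((\<lambda>t. matrix_inv (B t) ** P t) \<longlongrightarrow> L) (at_right 0)"
    show ?thesis
      using pos eventually_row_sum_pos[OF lim limit_nonneg limit_nonsingular]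
      by eventually_elim (use spl in \<open>auto intro: double_weak_splitting_I_converges\<close>)
  next
    assume spl: "\<forall>t>0. double_weak_splitting_II (B t) (P t) (R t) (S t)"
      and lim: "((\<lambda>t. P t ** matrix_inv (B t)) \<longlongrightarrow> L) (at_right 0)"
    show ?thesis
      using pos eventually_row_sum_pos[OF lim limit_nonneg limit_nonsingular]
      by eventually_elim (use spl in \<open>auto intro: double_weak_splitting_II_converges\<close>)
  qed
  have "invertible (regularized_gram A t)" if "0 < t" for t
    using splitting that
    by (auto simp: B_def double_weak_splitting_I_def double_weak_splitting_II_def)
  then show "((\<lambda>t. matrix_inv (B t) *v (transpose A *v b)) \<longlongrightarrow> moore_penrose A *v b) (at_right 0)"
    unfolding B_def by (rule regularized_gram_tendsto_moore_penrose)
qed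

end
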